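(* Let $N\ge2$ be an integer and let $\tilde\psi_0,\dots,\tilde\psi_N$ be the dual Bernstein polynomials of degree $N$, with the convention $\tilde\psi_i\equiv 0$ for $i<0$ and $i>N$. Set $\alpha_{i,0}=-(-1)^i(N+1)\binom{N+1}{i+1}+N\delta_{i,0}+\delta_{i,1}$ for $0\le i\le N$. Then for every $0\le i\le N$, $$\tilde\psi_i'(x)=\alpha_{i,0}\tilde\psi_0(x)+(1-\delta_{i,1})\,i\,\tilde\psi_{i-1}(x)+(1-\delta_{i,0})(1-\delta_{i,N})(N-2i)\tilde\psi_i(x)-(1-\delta_{i,N-1})(N-i)\tilde\psi_{i+1}(x)-\alpha_{N-i,0}\tilde\psi_N(x).$$
   Context: The Bernstein polynomials of degree $N$ on $[0,1]$ are $\phi_i(x)=\binom{N}{i}x^i(1-x)^{N-i}$, $0\le i\le N$. The dual Bernstein polynomials of degree $N$ are $\tilde\psi_i(x)=\sum_{j=0}^N c_{i,j}\phi_j(x)$, $0\le i\le N$, with $$c_{i,j}=\frac{(-1)^{i+j}}{\binom Ni\binom Nj}\sum_{r=0}^{\min(i,j)}(2r+1)\binom{N+r+1}{N-i}\binom{N-r}{N-i}\binom{N+r+1}{N-j}\binom{N-r}{N-j}.$$ They satisfy (known fact) $\int_0^1\phi_i\tilde\psi_j\,dx=\delta_{ij}$ for $0\le i,j\le N$, which characterizes them among polynomials of degree at most $N$. Here $\delta$ is the Kronecker delta. *)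

theory Defs
  imports "HOL-Analysis.Analysis"
begin

definition dual_coeff :: "nat \<Rightarrow> nat \<Rightarrow> nat \<Rightarrow> real" where
  "dual_coeff N i j =
     (-1) ^ (i + j) / (real (N choose i) * real (N choose j)) *
     (\<Sum>r = 0..min i j. (2 * real r + 1)
        * real ((N + r + 1) choose (N - i)) * real ((N - r) choose (N - i))
        * real ((N + r + 1) choose (N - j)) * real ((N - r) choose (N - j)))"

(* The index is an integer, so that the dual Bernstein polynomials with
   indices -1 and N + 1 make sense and are zero. *)
definition dual_Bernstein :: "nat \<Rightarrow> int \<Rightarrow> real \<Rightarrow> real" where
  "dual_Bernstein N i x =
     (if 0 \<le> i \<and> i \<le> int N
      then (\<Sum>j = 0..N. dual_coeff N (nat i) j * Bernstein N j x)
      else 0)"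

definition kronecker :: "nat \<Rightarrow> nat \<Rightarrow> real" where
  "kronecker i j = (if i = j then 1 else 0)"

(* The numbers alpha_{i,0}. *)
definition alpha0 :: "nat \<Rightarrow> nat \<Rightarrow> real" where
  "alpha0 N i =
     - ((-1) ^ i) * (real N + 1) * real ((N + 1) choose (i + 1))
     + real N * kronecker i 0 + kronecker i 1"

end

theory Submission
  imports Defs
begin

text \<open>
  The coefficients have the form \<open>c i j = (\<Sum>r\<le>N. (2 * r + 1) * h r i * h r j)\<close>. On Bernstein coefficients
  of degree \<open>N\<close>, differentiation acts as
  \<open>(L c) k = (N - k) * c (k + 1) + (2 * k - N) * c k - k * c (k - 1)\<close>,
  so the theorem amounts to \<open>L\<close> applied to \<open>c\<close> in one index plus \<open>L\<close> applied in the
  other being the rank-two boundary term \<open>c i N * c N k - c i 0 * c 0 k\<close>. This holds because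
  \<open>(2 * r + 1) * (h r i * (L (h r)) k + h r k * (L (h r)) i)\<close> is a hypergeometric difference
  \<open>F (r + 1) - F r\<close> with \<open>F (N + 1) = 0\<close>, and \<open>- F 0\<close> is the boundary term. The closed form of
  \<open>c i N\<close> comes from a similar telescoping sum; no integration or duality is needed.
\<close>

section \<open>Product form of the coefficients\<close>

definition dual_factor :: "nat \<Rightarrow> nat \<Rightarrow> nat \<Rightarrow> real" where
  "dual_factor N r i = (-1) ^ i / real (N choose i)
     * real ((N + r + 1) choose (N - i)) * real ((N - r) choose (N - i))"

text \<open>For \<open>i < r \<le> N\<close> the binomial \<open>(N - r) choose (N - i)\<close>
  vanishes, so the range of \<open>r\<close> can be made independent of \<open>i\<close> and
  \<open>j\<close>.\<close>

lemma dual_coeff_eq_sum: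
  "dual_coeff N i j = (\<Sum>r\<le>N. (2 * real r + 1) * dual_factor N r i * dual_factor N r j)"
proof (cases "i \<le> N \<and> j \<le> N")
  case False
  \<comment> \<open>Division by zero makes both sides zero. This covers the index
    \<open>N + 1\<close> that occurs in the recurrence.\<close>
  then have "N choose i = 0 \<or> N choose j = 0" by auto
  then show ?thesis unfolding dual_coeff_def dual_factor_def by (elim disjE) (simp_all only:, simp_all)
next
  case True
  have "dual_coeff N i j = (\<Sum>r = 0..min i j. (2 * real r + 1) * dual_factor N r i * dual_factor N r j)"
    by (simp add: dual_coeff_def dual_factor_def sum_distrib_left power_add mult_ac)
  also have "\<dots> = (\<Sum>r\<le>N. (2 * real r + 1) * dual_factor N r i * dual_factor N r j)"
  proof (rule sum.mono_neutral_left)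
    show "\<forall>r\<in>{..N} - {0..min i j}. (2 * real r + 1) * dual_factor N r i * dual_factor N r j = 0"
    proof
      fix r assume r: "r \<in> {..N} - {0..min i j}"
      then have "N - r < N - i \<or> N - r < N - j"
        using True by auto
      then show "(2 * real r + 1) * dual_factor N r i * dual_factor N r j = 0"
        by (auto simp: dual_factor_def)
    qed
  qed (use True in auto)
  finally show ?thesis .
qed

section \<open>Reciprocal factorials and a common base for neighbouring factors\<close>

text \<open>The zero branch of the next two definitions encodes \<open>1 / (m - r)! = 0\<close> for \<open>r > m\<close>, so that the
  recurrences in \<open>m\<close> and \<open>r\<close> below hold without side conditions.\<close>

definition inv_fact_pair :: "nat \<Rightarrow> nat \<Rightarrow> real" where
  "inv_fact_pair m r = (if r \<le> m then 1 / (fact (m + r) * fact (m - r)) else 0)"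

definition inv_fact_pair1 :: "nat \<Rightarrow> nat \<Rightarrow> real" where
  "inv_fact_pair1 m r = (if r \<le> m then 1 / (fact (m + r + 1) * fact (m - r)) else 0)"

lemma inv_fact_pair1_Suc:
  "inv_fact_pair1 m r = (real m + real r + 2) * (real m + 1 - real r) * inv_fact_pair1 (Suc m) r"
proof (cases "r \<le> m")
  case True
  then obtain d where "m = r + d" using le_Suc_ex by blast
  then show ?thesis
    by (simp add: inv_fact_pair1_def Suc_diff_le divide_simps) (simp add: algebra_simps)
next
  case False
  then show ?thesis by (cases "r = Suc m") (auto simp: inv_fact_pair1_def)
qed

text \<open>This and the next rule reduce the values at \<open>r\<close> and at \<open>r + 1\<close>
  to one common value, as telescoping requires.\<close>

lemma inv_fact_pair_Suc_left:
  "inv_fact_pair (Suc m) r = (real m + real r + 2) * inv_fact_pair1 (Suc m) r"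
  by (simp add: inv_fact_pair1_def inv_fact_pair_def divide_simps)

lemma inv_fact_pair_Suc_Suc:
  "inv_fact_pair (Suc m) (Suc r) = (real m + 1 - real r) * inv_fact_pair1 (Suc m) r"
proof (cases "r \<le> m")
  case True
  then obtain d where "m = r + d" using le_Suc_ex by blast
  then show ?thesis
    by (simp add: inv_fact_pair_def inv_fact_pair1_def Suc_diff_le divide_simps)
next
  case False
  then show ?thesis by (cases "r = Suc m") (auto simp: inv_fact_pair_def inv_fact_pair1_def)
qed

text \<open>With binomials written as factorials, only \<open>inv_fact_pair1 i r\<close> depends on
  \<open>i\<close> and \<open>r\<close> jointly.\<close>

lemma dual_factor_closed:
  assumes "r \<le> N" "i \<le> N"
  shows "dual_factor N r i = (-1) ^ i * fact i / (fact N * fact (N - i))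
           * (fact (N + r + 1) * fact (N - r)) * inv_fact_pair1 i r"
proof (cases "r \<le> i")
  case True
  have "real (N choose i) = fact N / (fact i * fact (N - i))"
    using assms by (simp add: binomial_fact)
  moreover have "real ((N + r + 1) choose (N - i))
      = fact (N + r + 1) / (fact (N - i) * fact (i + r + 1))"
  proof -
    have "N + r + 1 - (N - i) = i + r + 1" using assms by simp
    then show ?thesis using binomial_fact[of "N - i" "N + r + 1", where ?'a = real] by simp
  qed
  moreover have "real ((N - r) choose (N - i)) = fact (N - r) / (fact (N - i) * fact (i - r))"
  proof -
    have "N - r - (N - i) = i - r" "N - i \<le> N - r" using assms True by simp_all
    then show ?thesis using binomial_fact[of "N - i" "N - r", where ?'a = real] by simp
  qed
  ultimately show ?thesis
    using True unfolding dual_factor_def inv_fact_pair1_def by (simp add: mult_ac del: fact_Suc)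
next
  case False
  then have "N - r < N - i" using assms by simp
  then show ?thesis using False by (simp add: dual_factor_def inv_fact_pair1_def)
qed

text \<open>The operator \<open>L\<close> applied to one factor. At \<open>i = 0\<close> and
  \<open>i = N\<close> the neighbour outside the range has coefficient zero.\<close>

definition dual_factor_op :: "nat \<Rightarrow> nat \<Rightarrow> nat \<Rightarrow> real" where
  "dual_factor_op N r i = (real N - real i) * dual_factor N r (Suc i)
     + (2 * real i - real N) * dual_factor N r i
     - real i * dual_factor N r (i - 1)"

text \<open>A common multiple through which \<open>dual_factor\<close> at \<open>i - 1\<close>, \<open>i\<close> and \<open>i + 1\<close> are all polynomial.\<close>

definition dual_factor_base :: "nat \<Rightarrow> nat \<Rightarrow> nat \<Rightarrow> real" where
  "dual_factor_base N r i = (-1) ^ i * fact i / (fact N * fact (N - i) * (real N + 1 - real i))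
           * (fact (N + r + 1) * fact (N - r)) * inv_fact_pair1 (Suc i) r"

lemma dual_factor_eq_base:
  assumes "r \<le> N" "i \<le> N"
  shows "dual_factor N r i = dual_factor_base N r i
    * ((real N + 1 - real i) * (real i + real r + 2) * (real i + 1 - real r))"
proof -
  have "real N + 1 - real i \<noteq> 0" using assms by simp
  then show ?thesis
    by (simp add: dual_factor_closed[OF assms] dual_factor_base_def inv_fact_pair1_Suc[of i] del: fact_Suc)
qed

text \<open>The factor at \<open>i + 1\<close> already contains
  \<open>inv_fact_pair1 (Suc i) r\<close>; the one at \<open>i - 1\<close> reaches it by two uses of
  \<open>inv_fact_pair1_Suc\<close>.\<close>

lemma dual_factor_op_eq_base:
  assumes "r \<le> N" "i \<le> N"
  shows "dual_factor_op N r i = dual_factor_base N r i *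
    (- ((real N - real i)^2 * (real i + 1) * (real N + 1 - real i))
     + (real i + real r + 2) * (real i + 1 - real r)
       * ((2 * real i - real N) * (real N + 1 - real i) + (real i + real r + 1) * (real i - real r)))"
proof -
  have nz: "real N + 1 - real i \<noteq> 0" using assms by simp
  have up: "(real N - real i) * dual_factor N r (Suc i)
      = - dual_factor_base N r i * ((real N - real i)^2 * (real i + 1) * (real N + 1 - real i))"
  proof (cases "i = N")
    case False
    then have "i < N" using assms by simp
    then obtain d where N: "N = Suc (i + d)" using less_iff_Suc_add by auto
    have "dual_factor N r (Suc i) = - dual_factor_base N r i
        * ((real N - real i) * (real i + 1) * (real N + 1 - real i))"
      using nz \<open>i < N\<close>
      unfolding dual_factor_closed[OF \<open>r \<le> N\<close> Suc_leI[OF \<open>i < N\<close>]] dual_factor_base_def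
      by (simp add: divide_simps N Suc_diff_le)
    then show ?thesis by (simp add: power2_eq_square)
  qed simp
  have down: "real i * dual_factor N r (i - 1)
      = - dual_factor_base N r i * ((real i + real r + 2) * (real i + 1 - real r)
          * ((real i + real r + 1) * (real i - real r)))"
  proof (cases i)
    case 0
    \<comment> \<open>For \<open>r = 0\<close> and \<open>r = 1\<close> the polynomial on the right
      vanishes, for larger \<open>r\<close> the base does.\<close>
    then show ?thesis by (cases "r = 0 \<or> r = 1") (auto simp: dual_factor_base_def inv_fact_pair1_def)
  next
    case (Suc j)
    then have "j \<le> N" and jr: "real j = real i - 1" using assms by simp_all
    have f: "(fact (N - j) :: real) = (real N + 1 - real i) * fact (N - i)"
    proof -
      have "N - j = Suc (N - i)" using Suc assms by simp
      then show ?thesis using assms by (simp add: of_nat_diff algebra_simps)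
    qed
    have q: "inv_fact_pair1 j r = (real i + real r + 1) * (real i - real r) *
        ((real i + real r + 2) * (real i + 1 - real r) * inv_fact_pair1 (Suc i) r)"
      unfolding inv_fact_pair1_Suc[of j r] Suc[symmetric] inv_fact_pair1_Suc[of i r] jr by (simp add: add_ac)
    have fi: "(fact i :: real) = real i * fact j" and si: "(-1::real) ^ i = - ((-1) ^ j)" and ij: "i - 1 = j"
      using Suc by simp_all
    show ?thesis
      unfolding ij dual_factor_closed[OF \<open>r \<le> N\<close> \<open>j \<le> N\<close>] dual_factor_base_def f q fi si
      by (simp add: mult_ac del: fact_Suc)
  qed
  show ?thesis
    unfolding dual_factor_op_def up down dual_factor_eq_base[OF assms] by (simp add: algebra_simps)
qed

section \<open>Telescoping of the symmetric sum\<close>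

text \<open>The polynomial part of the antidifference \<open>F\<close>, with \<open>s = r\<^sup>2\<close>; found by solving Gosper's
  equation, which is the identity below.\<close>

definition tele_poly :: "real \<Rightarrow> real \<Rightarrow> real \<Rightarrow> real \<Rightarrow> real" where
  "tele_poly n a b s = - ((n + 2) * (a + b - n) * (a + 1) * (b + 1))
     + ((n + 2) * (a + b - n) + (a + 1) * (b + 1) + (a - b)^2) * s - s^2"

text \<open>This is the telescoping step after cancelling the two bases
  \<open>dual_factor_base\<close> at \<open>a\<close> and \<open>b\<close>.\<close>

lemma tele_poly_identity:
  fixes n a b r :: real
  shows "(2 * r + 1) *
     ((n + 1 - a) * (a + r + 2) * (a + 1 - r) *
       (- ((n - b)^2 * (b + 1) * (n + 1 - b))
        + (b + r + 2) * (b + 1 - r) * ((2 * b - n) * (n + 1 - b) + (b + r + 1) * (b - r)))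
    + (n + 1 - b) * (b + r + 2) * (b + 1 - r) *
       (- ((n - a)^2 * (a + 1) * (n + 1 - a))
        + (a + r + 2) * (a + 1 - r) * ((2 * a - n) * (n + 1 - a) + (a + r + 1) * (a - r))))
   = ((n + 2 + r)^2 * (a + 1 - r) * (b + 1 - r) * tele_poly n a b ((r + 1)^2)
      - (n + 1 - r)^2 * (a + r + 2) * (b + r + 2) * tele_poly n a b (r^2))"
  unfolding tele_poly_def by algebra

text \<open>The hypergeometric part of \<open>F\<close>. The shifts relative to
  \<open>dual_factor_base\<close> make its values at \<open>r\<close> and \<open>r + 1\<close>
  polynomial multiples of that base at \<open>r\<close>.\<close>

definition tele_base :: "nat \<Rightarrow> nat \<Rightarrow> nat \<Rightarrow> real" where
  "tele_base N r i = (-1) ^ i * fact i / (fact N * fact (N - i) * (real N + 1 - real i))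
           * (fact (N + r + 1) * fact (N + 1 - r)) * inv_fact_pair (Suc i) r"

lemma tele_base_eq:
  assumes "r \<le> N"
  shows "tele_base N r i = dual_factor_base N r i * ((real N + 1 - real r) * (real i + real r + 2))"
proof -
  have "(fact (N + 1 - r) :: real) = (real N + 1 - real r) * fact (N - r)"
    using assms by (simp add: Suc_diff_le of_nat_diff algebra_simps)
  then show ?thesis
    unfolding tele_base_def dual_factor_base_def inv_fact_pair_Suc_left
    by (simp only:) (simp add: mult_ac del: fact_Suc)
qed

lemma tele_base_Suc:
  "tele_base N (Suc r) i = dual_factor_base N r i * ((real N + 2 + real r) * (real i + 1 - real r))"
proof -
  have "(fact (N + Suc r + 1) :: real) = (real N + 2 + real r) * fact (N + r + 1)"
    by (simp add: algebra_simps)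
  then show ?thesis
    unfolding tele_base_def dual_factor_base_def inv_fact_pair_Suc_Suc
    by (simp only:) (simp add: mult_ac del: fact_Suc)
qed

lemma sum_dual_factor_op:
  assumes "i \<le> N" "k \<le> N"
  shows "(\<Sum>r\<le>N. (2 * real r + 1) * (dual_factor N r i * dual_factor_op N r k
      + dual_factor N r k * dual_factor_op N r i))
    = tele_base N 0 i * tele_base N 0 k
      * ((real N + 2) * (real i + real k - real N) * (real i + 1) * (real k + 1))"
proof -
  define F where "F r = tele_base N r i * tele_base N r k
    * tele_poly (real N) (real i) (real k) ((real r)^2)" for r
  have step: "(2 * real r + 1) * (dual_factor N r i * dual_factor_op N r k
      + dual_factor N r k * dual_factor_op N r i) = F (Suc r) - F r"
    if "r \<le> N" for r
  proof -
    have S: "real (Suc r) = real r + 1" by simp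
    show ?thesis
      unfolding F_def S tele_base_Suc tele_base_eq[OF that] dual_factor_eq_base[OF that assms(1)]
        dual_factor_eq_base[OF that assms(2)] dual_factor_op_eq_base[OF that assms(1)]
        dual_factor_op_eq_base[OF that assms(2)]
      using tele_poly_identity[of "real r" "real N" "real i" "real k"] by algebra
  qed
  have "(\<Sum>r\<le>N. (2 * real r + 1) * (dual_factor N r i * dual_factor_op N r k
      + dual_factor N r k * dual_factor_op N r i))
      = (\<Sum>r\<le>N. F (Suc r) - F r)"
    by (intro sum.cong) (simp_all add: step)
  also have "\<dots> = F (Suc N) - F 0"
    using sum_telescope[of "\<lambda>r. - F r" N] by simp
  \<comment> \<open>If \<open>i < N\<close> or \<open>k < N\<close>, a reciprocal factorial
    vanishes. For \<open>i = k = N\<close> none does, but \<open>(N + 1)^2\<close> is a root of the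
    polynomial part.\<close>
  also have "F (Suc N) = 0"
  proof (cases "i = N \<and> k = N")
    case True
    have "tele_poly n n n s = ((n + 1)^2 - s) * (s - n * (n + 2))" for n s :: real
    proof -
      have "- ((n + 2) * n * (n + 1) * (n + 1)) + ((n + 2) * n + (n + 1) * (n + 1)) * s - s^2
          = ((n + 1)^2 - s) * (s - n * (n + 2))"
        by algebra
      then show ?thesis by (simp add: tele_poly_def)
    qed
    then have "tele_poly n n n ((n + 1)^2) = 0" for n :: real by simp
    from this[of "real N"] show ?thesis using True by (simp add: F_def add.commute)
  next
    case False
    then have "inv_fact_pair (Suc i) (Suc N) = 0 \<or> inv_fact_pair (Suc k) (Suc N) = 0"
      using assms by (auto simp: inv_fact_pair_def)
    then show ?thesis by (auto simp: F_def tele_base_def)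
  qed
  finally show ?thesis by (simp add: F_def tele_poly_def)
qed

section \<open>Boundary coefficients and the recurrence\<close>

lemma dual_coeff_commute: "dual_coeff N i j = dual_coeff N j i"
  by (simp add: dual_coeff_eq_sum mult_ac)

lemma dual_coeff_0_right:
  assumes "i \<le> N"
  shows "dual_coeff N i 0 = tele_base N 0 i * ((real N + 1 - real i) * (real i + 1))"
proof -
  \<comment> \<open>Only \<open>r = 0\<close> survives, since \<open>dual_factor N r 0 = 0\<close>
    for \<open>0 < r \<le> N\<close>.\<close>
  have "dual_coeff N i 0 = (\<Sum>r\<in>{0}. (2 * real r + 1) * dual_factor N r i * dual_factor N r 0)"
    unfolding dual_coeff_eq_sum
    by (rule sum.mono_neutral_right) (auto simp: dual_factor_closed inv_fact_pair1_def)
  also have "\<dots> = dual_factor N 0 i * (real N + 1)"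
    by (simp add: dual_factor_def)
  finally show ?thesis
    by (simp add: dual_factor_eq_base[OF le0 assms] tele_base_eq)
qed

text \<open>Since \<open>dual_factor N r N = (-1) ^ N\<close> for every \<open>r\<close>, only one
  factor is left in the sum, and it has the antidifference \<open>G\<close>.\<close>

lemma dual_coeff_N_right:
  assumes "i \<le> N"
  shows "dual_coeff N i N = (-1) ^ N * (tele_base N 0 i * (real i + 1)^2)"
proof -
  define G where "G r = - tele_base N r i * ((real i + 1)^2 - (real r)^2)" for r
  have step: "(2 * real r + 1) * dual_factor N r i = G (Suc r) - G r" if "r \<le> N" for r
  proof -
    have S: "real (Suc r) = real r + 1" by simp
    show ?thesis
      unfolding G_def S tele_base_Suc tele_base_eq[OF that] dual_factor_eq_base[OF that assms]
      by algebra
  qed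
  have "dual_coeff N i N = (-1) ^ N * (\<Sum>r\<le>N. (2 * real r + 1) * dual_factor N r i)"
    unfolding dual_coeff_eq_sum sum_distrib_left by (simp add: dual_factor_def mult_ac)
  also have "(\<Sum>r\<le>N. (2 * real r + 1) * dual_factor N r i) = (\<Sum>r\<le>N. G (Suc r) - G r)"
    by (intro sum.cong) (simp_all add: step)
  also have "\<dots> = G (Suc N) - G 0"
    using sum_telescope[of "\<lambda>r. - G r" N] by simp
  also have "G (Suc N) = 0"
    using assms by (cases "i = N") (auto simp: G_def tele_base_def inv_fact_pair_def add.commute)
  finally show ?thesis by (simp add: G_def)
qed

lemma dual_coeff_recurrence:
  assumes "i \<le> N" "k \<le> N"
  shows "(real N - real k) * dual_coeff N i (Suc k) + (2 * real k - real N) * dual_coeff N i k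
       - real k * dual_coeff N i (k - 1)
     = - dual_coeff N i 0 * dual_coeff N 0 k + real i * dual_coeff N (i - 1) k
       + (real N - 2 * real i) * dual_coeff N i k - (real N - real i) * dual_coeff N (Suc i) k
       + dual_coeff N i N * dual_coeff N N k"
proof -
  have "(real N - real k) * dual_coeff N i (Suc k) + (2 * real k - real N) * dual_coeff N i k
       - real k * dual_coeff N i (k - 1) +
      ((real N - real i) * dual_coeff N (Suc i) k + (2 * real i - real N) * dual_coeff N i k
       - real i * dual_coeff N (i - 1) k)
    = (\<Sum>r\<le>N. (2 * real r + 1) * (dual_factor N r i * dual_factor_op N r k
      + dual_factor N r k * dual_factor_op N r i))"
    unfolding dual_coeff_eq_sum sum_distrib_left sum.distrib[symmetric] sum_subtractf[symmetric]
    by (intro sum.cong) (simp_all add: dual_factor_op_def algebra_simps)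
  also have "\<dots> = dual_coeff N i N * dual_coeff N N k - dual_coeff N i 0 * dual_coeff N 0 k"
  proof -
    \<comment> \<open>The boundary term matches because
      \<open>(i+1)(k+1) - (N+1-i)(N+1-k) = (N+2)(i+k-N)\<close>; the two signs
      \<open>(-1) ^ N\<close> cancel.\<close>
    define e where "e = (-1::real) ^ N"
    have "e * e = 1" by (simp add: e_def flip: power_add)
    then show ?thesis
      unfolding sum_dual_factor_op[OF assms] dual_coeff_commute[of N N k] dual_coeff_commute[of N 0 k]
        dual_coeff_N_right[OF assms(1)] dual_coeff_N_right[OF assms(2)]
        dual_coeff_0_right[OF assms(1)] dual_coeff_0_right[OF assms(2)] e_def[symmetric]
      by algebra
  qed
  finally show ?thesis by (simp add: algebra_simps)
qed

lemma dual_coeff_0_right_binomial: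
  assumes "i \<le> N"
  shows "dual_coeff N i 0 = (-1) ^ i * (real N + 1) * real ((N + 1) choose (i + 1))"
proof -
  have "real N + 1 - real i \<noteq> 0" using assms by simp
  moreover have "real ((N + 1) choose (i + 1)) = fact (N + 1) / (fact (i + 1) * fact (N - i))"
    using assms binomial_fact[of "i + 1" "N + 1", where ?'a = real] by simp
  ultimately show ?thesis
    unfolding dual_coeff_0_right[OF assms] tele_base_def
    by (simp only:) (simp add: inv_fact_pair_def divide_simps, simp add: add.commute)
qed

text \<open>The form mirrors \<open>dual_coeff N (N - i) 0\<close>, which is how
  \<open>alpha0 N (N - i)\<close> enters the theorem.\<close>

lemma dual_coeff_N_right_binomial:
  assumes "i \<le> N"
  shows "dual_coeff N i N = (-1) ^ (N - i) * (real N + 1) * real ((N + 1) choose (N - i + 1))"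
proof -
  have "real N + 1 - real i \<noteq> 0" using assms by simp
  moreover have "real ((N + 1) choose (N - i + 1)) = fact (N + 1) / (fact (N - i + 1) * fact i)"
    using assms binomial_fact[of "N - i + 1" "N + 1", where ?'a = real] by simp
  moreover have "(-1::real) ^ (N - i) = (-1) ^ N * (-1) ^ i"
    using assms by (simp add: neg_one_power_add_eq_neg_one_power_diff flip: power_add)
  moreover have "(fact (N - i + 1) :: real) = (real N + 1 - real i) * fact (N - i)"
    using assms by (simp add: of_nat_diff algebra_simps)
  ultimately show ?thesis
    unfolding dual_coeff_N_right[OF assms] tele_base_def
    by (simp only:) (simp add: inv_fact_pair_def divide_simps power2_eq_square, simp add: add.commute)
qed

section \<open>Derivatives of Bernstein polynomials\<close>

lemma real_choose_Suc:
  assumes "k \<le> n"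
  shows "(real k + 1) * real (n choose Suc k) = (real n - real k) * real (n choose k)"
proof -
  have "Suc k * (n choose Suc k) = (n - k) * (n choose k)"
    unfolding binomial_absorption binomial_absorb_comp ..
  then have "real (Suc k * (n choose Suc k)) = real ((n - k) * (n choose k))" by (rule arg_cong)
  then show ?thesis
    using assms unfolding of_nat_mult by (simp add: of_nat_diff add.commute)
qed

lemma has_real_derivative_Bernstein:
  assumes "j \<le> N"
  shows "(Bernstein N j has_real_derivative
      (if j = 0 then 0 else (real N - real j + 1) * Bernstein N (j - 1) x)
      + (2 * real j - real N) * Bernstein N j x - (real j + 1) * Bernstein N (Suc j) x) (at x)"
proof -
  have d: "(Bernstein N j has_real_derivative
      real (N choose j) * (real j * x ^ (j - 1) * (1 - x) ^ (N - j)
        - x ^ j * (real (N - j) * (1 - x) ^ (N - j - 1)))) (at x)"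
    unfolding Bernstein_def [abs_def]
    by (auto intro!: derivative_eq_intros simp: algebra_simps)
  \<comment> \<open>Multiplying by \<open>1 = (1 - x) + x\<close> raises the degree from
    \<open>N - 1\<close> to \<open>N\<close>; \<open>hi\<close> does the same for the other
    term.\<close>
  have lo: "real (N choose j) * (real j * x ^ (j - 1) * (1 - x) ^ (N - j))
     = (if j = 0 then 0 else (real N - real j + 1) * Bernstein N (j - 1) x) + real j * Bernstein N j x"
  proof (cases j)
    case (Suc m)
    then have e: "(1 - x) ^ (N - m) = (1 - x) * (1 - x) ^ (N - j)" "j - 1 = m"
        "real j = real m + 1" "N choose j = N choose Suc m" "x ^ j = x * x ^ m" "j \<noteq> 0"
      using assms Suc_diff_le[of j N] by auto
    have c: "(real m + 1) * real (N choose Suc m) = (real N - real m) * real (N choose m)"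
      using real_choose_Suc[of m N] assms Suc by simp
    define X Y where "X = x ^ m" and "Y = (1 - x) ^ (N - j)"
    show ?thesis
      unfolding Bernstein_def e if_not_P[OF \<open>j \<noteq> 0\<close>] X_def[symmetric] Y_def[symmetric]
      using c by algebra
  qed simp
  have hi: "real (N choose j) * (x ^ j * (real (N - j) * (1 - x) ^ (N - j - 1)))
     = (real N - real j) * Bernstein N j x + (real j + 1) * Bernstein N (Suc j) x"
  proof (cases "j = N")
    case False
    then have e: "(1 - x) ^ (N - j) = (1 - x) * (1 - x) ^ (N - Suc j)" "N - j - 1 = N - Suc j"
        "real (N - j) = real N - real j" "x ^ Suc j = x * x ^ j"
      using assms Suc_diff_Suc[of j N] by (auto simp flip: power_Suc)
    define X Y where "X = x ^ j" and "Y = (1 - x) ^ (N - Suc j)"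
    show ?thesis
      unfolding Bernstein_def e X_def[symmetric] Y_def[symmetric]
      using real_choose_Suc[OF assms] by algebra
  qed (simp add: Bernstein_def)
  show ?thesis
    using d by (rule DERIV_cong) (use lo hi in \<open>simp add: algebra_simps\<close>)
qed

section \<open>From coefficients to polynomials\<close>

theorem corollary1:
  fixes N i :: nat and x :: real
  assumes "N \<ge> 2" and "i \<le> N"
  shows "(dual_Bernstein N (int i) has_real_derivative
            alpha0 N i * dual_Bernstein N 0 x
          + (1 - kronecker i 1) * real i * dual_Bernstein N (int i - 1) x
          + (1 - kronecker i 0) * (1 - kronecker i N) * (real N - 2 * real i)
              * dual_Bernstein N (int i) x
          - (1 - kronecker i (N - 1)) * (real N - real i) * dual_Bernstein N (int i + 1) x
          - alpha0 N (N - i) * dual_Bernstein N (int N) x) (at x)"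
proof -
  define B where "B k = Bernstein N k x" for k
  have dB: "dual_Bernstein N (int m) x = (\<Sum>k\<le>N. dual_coeff N m k * B k)" if "m \<le> N" for m
    using that by (simp add: dual_Bernstein_def B_def atMost_atLeast0)
  have "dual_Bernstein N (int i) = (\<lambda>x. \<Sum>j\<le>N. dual_coeff N i j * Bernstein N j x)"
    using assms(2) by (simp add: fun_eq_iff dual_Bernstein_def atMost_atLeast0)
  then have "(dual_Bernstein N (int i) has_real_derivative
      (\<Sum>j\<le>N. dual_coeff N i j * ((if j = 0 then 0 else (real N - real j + 1) * B (j - 1))
      + (2 * real j - real N) * B j - (real j + 1) * B (Suc j)))) (at x)"
    unfolding B_def
    by (auto intro!: DERIV_sum DERIV_cmult has_real_derivative_Bernstein)
  also have "(\<Sum>j\<le>N. dual_coeff N i j * ((if j = 0 then 0 else (real N - real j + 1) * B (j - 1))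
      + (2 * real j - real N) * B j - (real j + 1) * B (Suc j)))
    = (\<Sum>k\<le>N. ((real N - real k) * dual_coeff N i (Suc k) + (2 * real k - real N) * dual_coeff N i k
       - real k * dual_coeff N i (k - 1)) * B k)"
  proof -
    \<comment> \<open>The index shifts leave no boundary terms: the top one vanishes by
      \<open>B (Suc N) = 0\<close> in one sum and by the factor \<open>N - k\<close> in the
      other.\<close>
    have BN: "B (Suc N) = 0" by (simp add: B_def Bernstein_def)
    have bot: "(\<Sum>j\<le>N. u j) = u 0 + (\<Sum>j<N. u (Suc j))" for u :: "nat \<Rightarrow> real"
      by (rule sum.atMost_shift)
    have top: "(\<Sum>j\<le>N. u j) = (\<Sum>j<N. u j) + u N" for u :: "nat \<Rightarrow> real"
      by (simp flip: lessThan_Suc_atMost)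
    have 1: "(\<Sum>j\<le>N. if j = 0 then 0 else dual_coeff N i j * (real N - real j + 1) * B (j - 1))
      = (\<Sum>k\<le>N. (real N - real k) * dual_coeff N i (Suc k) * B k)"
      unfolding bot[of "\<lambda>j. if j = 0 then 0 else _ j"] top by (simp add: mult_ac)
    have 2: "(\<Sum>j\<le>N. (real j + 1) * dual_coeff N i j * B (Suc j))
      = (\<Sum>k\<le>N. real k * dual_coeff N i (k - 1) * B k)"
      unfolding bot[of "\<lambda>k. real k * _ k * _ k"] top by (simp add: BN algebra_simps)
    have "(\<Sum>j\<le>N. dual_coeff N i j * ((if j = 0 then 0 else (real N - real j + 1) * B (j - 1))
        + (2 * real j - real N) * B j - (real j + 1) * B (Suc j)))
      = (\<Sum>j\<le>N. (if j = 0 then 0 else dual_coeff N i j * (real N - real j + 1) * B (j - 1))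
        + (2 * real j - real N) * dual_coeff N i j * B j
        - (real j + 1) * dual_coeff N i j * B (Suc j))"
      by (intro sum.cong refl) (simp add: right_diff_distrib distrib_left mult_ac)
    then show ?thesis
      unfolding sum.distrib sum_subtractf 1 2 left_diff_distrib[of _ _ "B _"] distrib_right[of _ _ "B _"]
      by simp
  qed
  also have "\<dots> = - dual_coeff N i 0 * dual_Bernstein N 0 x
       + real i * dual_Bernstein N (int i - 1) x
       + (real N - 2 * real i) * dual_Bernstein N (int i) x
       - (real N - real i) * dual_Bernstein N (int i + 1) x
       + dual_coeff N i N * dual_Bernstein N (int N) x"
  proof -
    \<comment> \<open>At \<open>i = N\<close> here, and at \<open>i = 0\<close> in
      \<open>down\<close>, the prefactor is zero, so the differing index conventions agree.\<close>
    have up: "(real N - real i) * dual_Bernstein N (int i + 1) x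
      = (real N - real i) * (\<Sum>k\<le>N. dual_coeff N (Suc i) k * B k)"
      using dB[of "Suc i"] assms(2) by (cases "i = N") (auto simp: add.commute)
    have down: "real i * dual_Bernstein N (int i - 1) x
      = real i * (\<Sum>k\<le>N. dual_coeff N (i - 1) k * B k)"
      using dB[of "i - 1"] assms(2) by (cases i) auto
    have zero: "dual_Bernstein N 0 x = (\<Sum>k\<le>N. dual_coeff N 0 k * B k)" using dB[of 0] by simp
    show ?thesis
      unfolding up down zero dB[OF assms(2)] dB[OF order_refl] sum_distrib_left
        sum.distrib[symmetric] sum_subtractf[symmetric]
      by (intro sum.cong refl)
        (simp only: atMost_iff dual_coeff_recurrence[OF assms(2)], simp add: algebra_simps)
  qed
  also have "\<dots> = alpha0 N i * dual_Bernstein N 0 x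
          + (1 - kronecker i 1) * real i * dual_Bernstein N (int i - 1) x
          + (1 - kronecker i 0) * (1 - kronecker i N) * (real N - 2 * real i)
              * dual_Bernstein N (int i) x
          - (1 - kronecker i (N - 1)) * (real N - real i) * dual_Bernstein N (int i + 1) x
          - alpha0 N (N - i) * dual_Bernstein N (int N) x"
  proof -
    \<comment> \<open>The Kronecker deltas only move terms: for \<open>i = 0, 1\<close> a multiple
      of the polynomial of index 0 goes into \<open>alpha0 N i\<close>, for
      \<open>i = N, N - 1\<close> one of index \<open>N\<close> into
      \<open>alpha0 N (N - i)\<close>. For \<open>N = 2\<close> the indices \<open>1\<close> and
      \<open>N - 1\<close> coincide.\<close>
    have "int i + 1 = int N" if "i = N - 1" using that assms(1) by simp
    moreover have "N - i = 0 \<longleftrightarrow> i = N" "N - i = 1 \<longleftrightarrow> i = N - 1" using assms by auto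
    moreover have "real (N - 1) = real N - 1" using assms(1) by simp
    moreover have "i = 0 \<or> i = 1 \<or> i = 2" if "N = 2" using that assms(2) by auto
    ultimately show ?thesis
      unfolding alpha0_def kronecker_def dual_coeff_0_right_binomial[OF assms(2)]
        dual_coeff_N_right_binomial[OF assms(2)]
      using assms by (cases "N = 2") (auto simp: algebra_simps)
  qed
  finally show ?thesis .
qed

end
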